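(* Let $(W,S)$ be the finite Coxeter system of type $H_4$, that is, $S=\{s_1,s_2,s_3,s_4\}$ and $W$ is the group generated by $S$ subject to the relations $(s_is_j)^{m_{ij}}=1$, where $m_{ii}=1$, $m_{ij}=m_{ji}$, $m_{12}=5$, $m_{23}=m_{34}=3$, and all other $m_{ij}$ with $i\neq j$ equal $2$. Let $W(H_4)$ denote the set $W$ partially ordered by the right weak order $\leq_R$. Then the order dimension of this finite poset satisfies $\dim W(H_4)\geq 5$.
   Context: For a finite Coxeter system $(W,S)$, let $\ell$ denote Coxeter length with respect to $S$. The right weak order on $W$ is defined by $u\leq_R v$ if $v=uq$ for some $q\in W$ with $\ell(v)=\ell(u)+\ell(q)$. Equivalently, $u\leq_R v$ if and only if $\operatorname{Inv}(u)\subseteq\operatorname{Inv}(v)$, where $\operatorname{Inv}(w)=\{\alpha\in\Phi^+ : w^{-1}(\alpha)\in-\Phi^+\}$ and $\Phi^+$ is the set of positive roots of the associated root system. This poset is identified with the poset of regions of the Coxeter (reflection) arrangement of $W$ based at the fundamental region. A realizer of a finite poset $P$ is a collection of linear extensions of $P$ whose intersection (as relations) is the order of $P$. The order dimension $\dim P$ is the minimum size of a realizer of $P$; equivalently, it is the least $d$ such that $P$ admits an order embedding into $\mathbb{R}^d$ with the coordinatewise order. *)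

theory Defs
  imports "HOL-Algebra.Group" "HOL-Library.Extended_Nat"
begin

section \<open>Groups given by generators and relators\<close>

datatype 'i letter = Gen 'i | Inv 'i

inductive pres_eq :: "'i letter list set \<Rightarrow> 'i letter list \<Rightarrow> 'i letter list \<Rightarrow> bool"
  for R :: "'i letter list set"
where
  relator: "r \<in> R \<Longrightarrow> pres_eq R r []"
| cancel1: "pres_eq R [Gen i, Inv i] []"
| cancel2: "pres_eq R [Inv i, Gen i] []"
| refl: "pres_eq R u u"
| sym: "pres_eq R u v \<Longrightarrow> pres_eq R v u"
| trans: "pres_eq R u v \<Longrightarrow> pres_eq R v w \<Longrightarrow> pres_eq R u w"
| append: "pres_eq R u u' \<Longrightarrow> pres_eq R v v' \<Longrightarrow> pres_eq R (u @ v) (u' @ v')"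

definition word_class :: "'i letter list set \<Rightarrow> 'i letter list \<Rightarrow> 'i letter list set" where
  "word_class R w = {v. pres_eq R w v}"

text \<open>The group \<open>\<langle> 'i | R \<rangle>\<close>, generated by all elements of the type \<open>'i\<close>.\<close>

definition presented_group :: "'i letter list set \<Rightarrow> 'i letter list set monoid" where
  "presented_group R =
     \<lparr> carrier = range (word_class R),
       monoid.mult = (\<lambda>A B. \<Union>a\<in>A. \<Union>b\<in>B. word_class R (a @ b)),
       one = word_class R [] \<rparr>"

lemma word_class_eq_iff: "word_class R u = word_class R v \<longleftrightarrow> pres_eq R u v"
proof
  have "v \<in> word_class R v" by (simp add: word_class_def pres_eq.refl)
  then show "pres_eq R u v" if "word_class R u = word_class R v"
    using that by (auto simp: word_class_def)
  show "word_class R u = word_class R v" if "pres_eq R u v"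
    using that pres_eq.trans[OF that] pres_eq.trans[OF pres_eq.sym[OF that]]
    unfolding word_class_def by blast
qed

lemma presented_group_mult [simp]:
  "word_class R u \<otimes>\<^bsub>presented_group R\<^esub> word_class R v = word_class R (u @ v)"
proof -
  have "word_class R (a @ b) = word_class R (u @ v)"
    if "a \<in> word_class R u" "b \<in> word_class R v" for a b
  proof -
    have "pres_eq R (u @ v) (a @ b)"
      using that by (intro pres_eq.append) (simp_all add: word_class_def)
    then show ?thesis by (metis word_class_eq_iff)
  qed
  moreover have "u \<in> word_class R u" "v \<in> word_class R v"
    by (simp_all add: word_class_def pres_eq.refl)
  ultimately have "(\<Union>a\<in>word_class R u. \<Union>b\<in>word_class R v. word_class R (a @ b))
      = word_class R (u @ v)"
    by blast
  then show ?thesis by (simp add: presented_group_def)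
qed

lemma presented_group_one: "\<one>\<^bsub>presented_group R\<^esub> = word_class R []"
  by (simp add: presented_group_def)

lemma presented_group_carrier: "carrier (presented_group R) = range (word_class R)"
  by (simp add: presented_group_def)

fun invert_letter :: "'i letter \<Rightarrow> 'i letter" where
  "invert_letter (Gen i) = Inv i"
| "invert_letter (Inv i) = Gen i"

lemma pres_eq_invert: "pres_eq R (rev (map invert_letter w) @ w) []"
proof (induction w)
  case Nil
  show ?case by (simp add: pres_eq.refl)
next
  case (Cons x w)
  have "pres_eq R ([invert_letter x] @ [x]) []"
    by (cases x) (simp_all add: pres_eq.cancel1 pres_eq.cancel2)
  then have "pres_eq R (([invert_letter x] @ [x]) @ w) ([] @ w)"
    by (rule pres_eq.append) (rule pres_eq.refl)
  then have "pres_eq R (rev (map invert_letter w) @ ([invert_letter x] @ [x]) @ w)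
      (rev (map invert_letter w) @ [] @ w)"
    by (rule pres_eq.append[OF pres_eq.refl])
  then have "pres_eq R (rev (map invert_letter (x # w)) @ x # w) (rev (map invert_letter w) @ w)"
    by simp
  from this Cons.IH show ?case by (rule pres_eq.trans)
qed

lemma group_presented_group: "group (presented_group R)"
proof (rule groupI)
  fix x assume "x \<in> carrier (presented_group R)"
  then obtain w where "x = word_class R w" by (auto simp: presented_group_carrier)
  then show "\<exists>y\<in>carrier (presented_group R). y \<otimes>\<^bsub>presented_group R\<^esub> x = \<one>\<^bsub>presented_group R\<^esub>"
    by (intro bexI[of _ "word_class R (rev (map invert_letter w))"])
      (auto simp: presented_group_carrier presented_group_one word_class_eq_iff pres_eq_invert)
qed (auto simp: presented_group_carrier presented_group_one)


section \<open>Coxeter groups\<close>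

text \<open>An entry \<open>m i j = 0\<close> stands for \<open>\<infinity>\<close>: its relator is the empty word.\<close>

definition coxeter_relators :: "('i \<Rightarrow> 'i \<Rightarrow> nat) \<Rightarrow> 'i letter list set" where
  "coxeter_relators m = {concat (replicate (m i j) [Gen i, Gen j]) | i j. True}"

definition coxeter_group :: "('i \<Rightarrow> 'i \<Rightarrow> nat) \<Rightarrow> 'i letter list set monoid" where
  "coxeter_group m = presented_group (coxeter_relators m)"

definition coxeter_gens :: "('i \<Rightarrow> 'i \<Rightarrow> nat) \<Rightarrow> 'i letter list set set" where
  "coxeter_gens m = (\<lambda>i. word_class (coxeter_relators m) [Gen i]) ` UNIV"

definition gen_prod :: "('a, 'b) monoid_scheme \<Rightarrow> 'a list \<Rightarrow> 'a" where
  "gen_prod G xs = foldr (\<lambda>x y. x \<otimes>\<^bsub>G\<^esub> y) xs \<one>\<^bsub>G\<^esub>"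

definition word_length :: "('a, 'b) monoid_scheme \<Rightarrow> 'a set \<Rightarrow> 'a \<Rightarrow> nat" where
  "word_length G S w = (LEAST n. \<exists>xs. set xs \<subseteq> S \<and> length xs = n \<and> gen_prod G xs = w)"

definition right_weak_order :: "('a, 'b) monoid_scheme \<Rightarrow> 'a set \<Rightarrow> 'a rel" where
  "right_weak_order G S =
     {(u, v). u \<in> carrier G \<and> v \<in> carrier G \<and>
        (\<exists>q\<in>carrier G. v = u \<otimes>\<^bsub>G\<^esub> q \<and>
           word_length G S v = word_length G S u + word_length G S q)}"

lemma (in group) gen_prod_closed: "set xs \<subseteq> carrier G \<Longrightarrow> gen_prod G xs \<in> carrier G"
  by (induction xs) (auto simp: gen_prod_def)

lemma (in group) gen_prod_append:
  "set xs \<subseteq> carrier G \<Longrightarrow> set ys \<subseteq> carrier G \<Longrightarrow>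
     gen_prod G (xs @ ys) = gen_prod G xs \<otimes> gen_prod G ys"
proof (induction xs)
  case Nil
  then show ?case using gen_prod_closed[of ys] by (simp add: gen_prod_def)
next
  case (Cons x xs)
  then show ?case
    using gen_prod_closed[of xs] gen_prod_closed[of ys] by (simp add: gen_prod_def m_assoc)
qed

lemma (in group) partial_order_right_weak_order:
  assumes S: "S \<subseteq> carrier G"
    and gen: "\<And>w. w \<in> carrier G \<Longrightarrow> \<exists>xs. set xs \<subseteq> S \<and> gen_prod G xs = w"
  shows "partial_order_on (carrier G) (right_weak_order G S)"
proof -
  let ?l = "word_length G S"
  have reduced: "\<exists>xs. set xs \<subseteq> S \<and> length xs = ?l w \<and> gen_prod G xs = w"
    if "w \<in> carrier G" for w
    using gen[OF that] unfolding word_length_def by - (rule LeastI_ex, auto)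
  have le: "?l (gen_prod G xs) \<le> length xs" if "set xs \<subseteq> S" for xs
    unfolding word_length_def using that by (intro Least_le) auto
  have zero: "?l \<one> = 0" using le[of "[]"] by (simp add: gen_prod_def)
  have one: "w = \<one>" if "w \<in> carrier G" "?l w = 0" for w
    using reduced[OF that(1)] that(2) by (auto simp: gen_prod_def)
  have sub: "?l (u \<otimes> v) \<le> ?l u + ?l v" if uv: "u \<in> carrier G" "v \<in> carrier G" for u v
  proof -
    from reduced uv obtain xs ys
      where "set xs \<subseteq> S" "length xs = ?l u" "gen_prod G xs = u"
        "set ys \<subseteq> S" "length ys = ?l v" "gen_prod G ys = v" by metis
    then show ?thesis using le[of "xs @ ys"] gen_prod_append[of xs ys] S by auto
  qed
  show ?thesis
    unfolding partial_order_on_def preorder_on_def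
  proof (intro conjI)
    show "right_weak_order G S \<subseteq> carrier G \<times> carrier G"
      by (auto simp: right_weak_order_def)
    show "refl_on (carrier G) (right_weak_order G S)"
      using zero by (auto simp: refl_on_def right_weak_order_def intro!: bexI[of _ \<one>])
    show "trans (right_weak_order G S)"
    proof (rule transI)
      fix u v w assume "(u, v) \<in> right_weak_order G S" "(v, w) \<in> right_weak_order G S"
      then obtain p q where
        c: "u \<in> carrier G" "p \<in> carrier G" "q \<in> carrier G" and
        v: "v = u \<otimes> p" "?l v = ?l u + ?l p" and w: "w = v \<otimes> q" "?l w = ?l v + ?l q"
        by (auto simp: right_weak_order_def)
      have w': "w = u \<otimes> (p \<otimes> q)" using c v w by (simp add: m_assoc)
      then have "?l w \<le> ?l u + ?l (p \<otimes> q)" using sub c by simp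
      moreover have "?l (p \<otimes> q) \<le> ?l p + ?l q" using sub c by simp
      ultimately have "?l w = ?l u + ?l (p \<otimes> q)" using v w by linarith
      with w' c show "(u, w) \<in> right_weak_order G S"
        unfolding right_weak_order_def by blast
    qed
    show "antisym (right_weak_order G S)"
    proof (rule antisymI)
      fix u v assume "(u, v) \<in> right_weak_order G S" "(v, u) \<in> right_weak_order G S"
      then obtain q where "u \<in> carrier G" "q \<in> carrier G" "v = u \<otimes> q" "?l q = 0"
        by (fastforce simp: right_weak_order_def)
      then show "u = v" using one by simp
    qed
  qed
qed


section \<open>Order dimension\<close>

definition linear_extension :: "'a set \<Rightarrow> 'a rel \<Rightarrow> 'a rel \<Rightarrow> bool" where
  "linear_extension A r L \<longleftrightarrow> linear_order_on A L \<and> r \<subseteq> L"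

text \<open>The empty collection is excluded because its intersection would be the full relation
  on the type rather than a relation on \<open>A\<close>.\<close>

definition realizer :: "'a set \<Rightarrow> 'a rel \<Rightarrow> 'a rel set \<Rightarrow> bool" where
  "realizer A r \<L> \<longleftrightarrow> \<L> \<noteq> {} \<and> (\<forall>L\<in>\<L>. linear_extension A r L) \<and> \<Inter>\<L> = r"

text \<open>The infimum is a minimum as soon as a finite realizer exists, as it does for every
  finite poset; it is \<open>\<infinity>\<close> otherwise.\<close>

definition order_dim :: "'a set \<Rightarrow> 'a rel \<Rightarrow> enat" where
  "order_dim A r = (INF \<L>\<in>{\<L>. finite \<L> \<and> realizer A r \<L>}. enat (card \<L>))"


section \<open>Type \<open>H\<^sub>4\<close>\<close>

datatype h4_gen = S1 | S2 | S3 | S4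

definition h4_matrix :: "h4_gen \<Rightarrow> h4_gen \<Rightarrow> nat" where
  "h4_matrix i j =
     (if i = j then 1
      else if {i, j} = {S1, S2} then 5
      else if {i, j} = {S2, S3} \<or> {i, j} = {S3, S4} then 3
      else 2)"

abbreviation W_H4 :: "h4_gen letter list set monoid" where
  "W_H4 \<equiv> coxeter_group h4_matrix"

abbreviation S_H4 :: "h4_gen letter list set set" where
  "S_H4 \<equiv> coxeter_gens h4_matrix"

lemma group_W_H4: "group W_H4"
  unfolding coxeter_group_def by (rule group_presented_group)

lemma gen_prod_W_H4:
  "gen_prod W_H4 (map (\<lambda>i. word_class (coxeter_relators h4_matrix) [Gen i]) is) =
     word_class (coxeter_relators h4_matrix) (map Gen is)"
  by (induction "is") (simp_all add: gen_prod_def coxeter_group_def presented_group_one)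

lemma W_H4_generated:
  assumes "w \<in> carrier W_H4"
  shows "\<exists>xs. set xs \<subseteq> S_H4 \<and> gen_prod W_H4 xs = w"
proof -
  let ?R = "coxeter_relators h4_matrix"
  have invol: "pres_eq ?R [Gen i, Gen i] []" for i
  proof (rule pres_eq.relator)
    show "[Gen i, Gen i] \<in> ?R"
      unfolding coxeter_relators_def
      by (rule CollectI, intro exI[of _ i]) (simp add: h4_matrix_def)
  qed
  have inv_gen: "pres_eq ?R [Inv i] [Gen i]" for i
  proof -
    have "pres_eq ?R ([Inv i] @ []) ([Inv i] @ [Gen i, Gen i])"
      by (intro pres_eq.append pres_eq.refl pres_eq.sym[OF invol])
    moreover have "pres_eq ?R ([Inv i, Gen i] @ [Gen i]) ([] @ [Gen i])"
      by (intro pres_eq.append pres_eq.refl pres_eq.cancel2)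
    ultimately have "pres_eq ?R [Inv i] [Inv i, Gen i, Gen i]" "pres_eq ?R [Inv i, Gen i, Gen i] [Gen i]"
      by simp_all
    then show ?thesis by (rule pres_eq.trans)
  qed
  have "\<exists>is. pres_eq ?R (map Gen is) v" for v
  proof (induction v)
    case Nil
    show ?case by (intro exI[of _ "[]"]) (simp add: pres_eq.refl)
  next
    case (Cons x v)
    then obtain "is" where v: "pres_eq ?R (map Gen is) v" by blast
    obtain i where "pres_eq ?R [Gen i] [x]"
    proof (cases x)
      case (Gen i)
      then show ?thesis using that[of i] pres_eq.refl[of ?R "[Gen i]"] by simp
    next
      case (Inv i)
      then show ?thesis using that[of i] pres_eq.sym[OF inv_gen] by simp
    qed
    from pres_eq.append[OF this v] show ?case by (intro exI[of _ "i # is"]) simp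
  qed
  moreover obtain v where "w = word_class ?R v"
    using assms by (auto simp: coxeter_group_def presented_group_carrier)
  ultimately obtain "is" where "w = word_class ?R (map Gen is)"
    by (metis word_class_eq_iff)
  then show ?thesis
    by (intro exI[of _ "map (\<lambda>i. word_class ?R [Gen i]) is"])
      (auto simp: gen_prod_W_H4 coxeter_gens_def)
qed

lemma partial_order_W_H4: "partial_order_on (carrier W_H4) (right_weak_order W_H4 S_H4)"
  by (rule group.partial_order_right_weak_order[OF group_W_H4 _ W_H4_generated])
    (auto simp: coxeter_gens_def coxeter_group_def presented_group_carrier)

end

theory Submission
  imports Defs
begin

text \<open>Let \<open>w\<^sub>0\<close> be the longest element. If the inversion sets of \<open>a\<close> and \<open>x\<close> meet, then \<open>a\<close> is not
  below \<open>x w\<^sub>0\<close>, so some linear extension of a realizer puts \<open>x w\<^sub>0\<close> below \<open>a\<close>. Two such pairs \<open>(a, x)\<close>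
  and \<open>(b, y)\<close> with \<open>a \<le> y w\<^sub>0\<close> and \<open>b \<le> x w\<^sub>0\<close> need different extensions, since otherwise
  \<open>a \<le> y w\<^sub>0 \<le> b \<le> x w\<^sub>0 \<le> a\<close> in one of them. A realizer thus colours the graph of these conflicts
  properly, and fifteen pairs span a subgraph that has no proper colouring with four colours.
  All comparisons are read off inversion sets, which requires that length counts inversions.\<close>

section \<open>The geometric representation\<close>

text \<open>\<open>Vec a a' b b' c c' d d'\<close> is the combination of the four simple roots with coefficients
  \<open>a + a'\<phi>\<close>, \<open>b + b'\<phi>\<close>, \<open>c + c'\<phi>\<close>, \<open>d + d'\<phi>\<close>, where \<open>\<phi>\<^sup>2 = \<phi> + 1\<close>. Nonnegativity of
  these eight integers is stronger than that of the four real coefficients, but all positive roots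
  have it, because \<open>H\<^sub>4\<close> is a folding of \<open>E\<^sub>8\<close>.\<close>

datatype hvec = Vec int int int int int int int int

fun vadd :: "hvec \<Rightarrow> hvec \<Rightarrow> hvec" where
  "vadd (Vec a a' b b' c c' d d') (Vec e e' f f' g g' h h') =
     Vec (a + e) (a' + e') (b + f) (b' + f') (c + g) (c' + g') (d + h) (d' + h')"

fun vneg :: "hvec \<Rightarrow> hvec" where
  "vneg (Vec a a' b b' c c' d d') = Vec (-a) (-a') (-b) (-b') (-c) (-c') (-d) (-d')"

fun smul :: "int \<times> int \<Rightarrow> hvec \<Rightarrow> hvec" where
  "smul (p, q) (Vec a a' b b' c c' d d') =
     Vec (p * a + q * a') (p * a' + q * (a + a')) (p * b + q * b') (p * b' + q * (b + b'))
       (p * c + q * c') (p * c' + q * (c + c')) (p * d + q * d') (p * d' + q * (d + d'))"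

fun coord :: "h4_gen \<Rightarrow> hvec \<Rightarrow> int \<times> int" where
  "coord S1 (Vec a a' b b' c c' d d') = (a, a')"
| "coord S2 (Vec a a' b b' c c' d d') = (b, b')"
| "coord S3 (Vec a a' b b' c c' d d') = (c, c')"
| "coord S4 (Vec a a' b b' c c' d d') = (d, d')"

fun nonneg :: "hvec \<Rightarrow> bool" where
  "nonneg (Vec a a' b b' c c' d d') \<longleftrightarrow>
     0 \<le> a \<and> 0 \<le> a' \<and> 0 \<le> b \<and> 0 \<le> b' \<and> 0 \<le> c \<and> 0 \<le> c' \<and> 0 \<le> d \<and> 0 \<le> d'"

fun simple_root :: "h4_gen \<Rightarrow> hvec" where
  "simple_root S1 = Vec 1 0 0 0 0 0 0 0"
| "simple_root S2 = Vec 0 0 1 0 0 0 0 0"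
| "simple_root S3 = Vec 0 0 0 0 1 0 0 0"
| "simple_root S4 = Vec 0 0 0 0 0 0 1 0"

text \<open>The bond labelled 5 contributes the factor 2 cos(\<pi>/5) = \<phi>, the bonds labelled 3
  the factor 1.\<close>

fun srefl :: "h4_gen \<Rightarrow> hvec \<Rightarrow> hvec" where
  "srefl S1 (Vec a a' b b' c c' d d') = Vec (b' - a) (b + b' - a') b b' c c' d d'"
| "srefl S2 (Vec a a' b b' c c' d d') = Vec a a' (a' + c - b) (a + a' + c' - b') c c' d d'"
| "srefl S3 (Vec a a' b b' c c' d d') = Vec a a' b b' (b + d - c) (b' + d' - c') d d'"
| "srefl S4 (Vec a a' b b' c c' d d') = Vec a a' b b' c c' (c - d) (c' - d')"

fun act :: "h4_gen list \<Rightarrow> hvec \<Rightarrow> hvec" where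
  "act [] v = v"
| "act (s # w) v = srefl s (act w v)"

lemma act_append: "act (u @ w) v = act u (act w v)"
  by (induction u) simp_all

lemma srefl_srefl [simp]: "srefl s (srefl s v) = v"
  by (cases s; cases v) simp_all

lemma act_rev_act [simp]: "act (rev w) (act w v) = v"
  by (induction w arbitrary: v) (simp_all add: act_append)

lemma act_act_rev [simp]: "act w (act (rev w) v) = v"
  using act_rev_act[of "rev w"] by simp

lemma vneg_vneg [simp]: "vneg (vneg v) = v"
  by (cases v) simp

lemma act_vneg: "act w (vneg v) = vneg (act w v)"
proof -
  have "srefl s (vneg v) = vneg (srefl s v)" for s v
    by (cases s; cases v) simp_all
  then show ?thesis by (induction w) simp_all
qed

lemma act_vadd: "act w (vadd u v) = vadd (act w u) (act w v)"
proof -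
  have "srefl s (vadd u v) = vadd (srefl s u) (srefl s v)" for s u v
    by (cases s; cases u; cases v) simp_all
  then show ?thesis by (induction w) simp_all
qed

lemma act_smul: "act w (smul c v) = smul c (act w v)"
proof -
  have "srefl s (smul c v) = smul c (srefl s v)" for s v
    by (cases s; cases v; cases c) (simp_all add: algebra_simps)
  then show ?thesis by (induction w) simp_all
qed

lemma srefl_simple_root_self: "srefl s (simple_root s) = vneg (simple_root s)"
  by (cases s) simp_all

lemma nonneg_vadd: "nonneg u \<Longrightarrow> nonneg v \<Longrightarrow> nonneg (vadd u v)"
  by (cases u; cases v) simp

lemma nonneg_smul: "nonneg v \<Longrightarrow> 0 \<le> fst c \<Longrightarrow> 0 \<le> snd c \<Longrightarrow> nonneg (smul c v)"
  by (cases v; cases c) simp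

section \<open>Enumeration of the positive roots\<close>

fun inv_list :: "h4_gen list \<Rightarrow> hvec list" where
  "inv_list [] = []"
| "inv_list (s # w) = simple_root s # map (srefl s) (inv_list w)"

text \<open>The Coxeter number of type H4 is 30, and a Coxeter element raised to half of it is the
  longest element, of length 60.\<close>

definition w0_word :: "h4_gen list" where
  "w0_word = concat (replicate 15 [S1, S2, S3, S4])"

definition pos_roots :: "hvec set" where
  "pos_roots = set (inv_list w0_word)"

definition gens :: "h4_gen list" where "gens = [S1, S2, S3, S4]"

lemma in_gens: "s \<in> set gens"
  by (cases s) (simp_all add: gens_def)

text \<open>Evaluation over the finite list; the last conjunct reflects that the longest element of
  type H4 acts as -1.\<close>

lemma pos_roots_check:
  "\<forall>b\<in>set (inv_list w0_word). nonneg b \<and> \<not> nonneg (vneg b) \<and> act w0_word b = vneg b"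
  by code_simp

text \<open>This classical fact makes \<open>roots\<close> stable under the action and gives each
  generator exactly one inversion.\<close>

lemma srefl_pos_roots_check:
  "\<forall>s\<in>set gens. simple_root s \<in> set (inv_list w0_word) \<and>
     (\<forall>b\<in>set (inv_list w0_word). b = simple_root s \<or> srefl s b \<in> set (inv_list w0_word))"
  by code_simp


section \<open>Roots and inversions\<close>

lemma pos_roots_nonneg: "b \<in> pos_roots \<Longrightarrow> nonneg b"
  and pos_roots_not_nonpos: "b \<in> pos_roots \<Longrightarrow> \<not> nonneg (vneg b)"
  using pos_roots_check by (auto simp: pos_roots_def)

lemma simple_root_pos: "simple_root s \<in> pos_roots"
  and srefl_pos: "b \<in> pos_roots \<Longrightarrow> b \<noteq> simple_root s \<Longrightarrow> srefl s b \<in> pos_roots"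
  using srefl_pos_roots_check in_gens[of s] by (auto simp: pos_roots_def)

lemma finite_pos_roots: "finite pos_roots"
  by (simp add: pos_roots_def)

lemma act_w0: "b \<in> pos_roots \<Longrightarrow> act w0_word b = vneg b"
  using pos_roots_check by (simp add: pos_roots_def)

definition roots :: "hvec set" where
  "roots = pos_roots \<union> vneg ` pos_roots"

lemma pos_imp_root: "b \<in> pos_roots \<Longrightarrow> b \<in> roots"
  by (simp add: roots_def)

lemma root_vneg_iff [simp]: "vneg b \<in> roots \<longleftrightarrow> b \<in> roots"
proof -
  have "vneg b \<in> roots" if "b \<in> roots" for b
    using that by (auto simp: roots_def)
  from this[of b] this[of "vneg b"] show ?thesis by auto
qed

lemma neg_root_iff: "b \<in> roots \<Longrightarrow> vneg b \<in> pos_roots \<longleftrightarrow> b \<notin> pos_roots"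
  using pos_roots_nonneg pos_roots_not_nonpos by (fastforce simp: roots_def)

lemma pos_root_iff: "b \<in> roots \<Longrightarrow> b \<in> pos_roots \<longleftrightarrow> nonneg b"
  using pos_roots_nonneg pos_roots_not_nonpos by (fastforce simp: roots_def)

lemma srefl_vneg: "srefl s (vneg v) = vneg (srefl s v)"
  using act_vneg[of "[s]"] by simp

lemma srefl_root: "b \<in> roots \<Longrightarrow> srefl s b \<in> roots"
proof -
  have pos: "srefl s b \<in> roots" if "b \<in> pos_roots" for b
    using that srefl_pos[OF that, of s] simple_root_pos[of s]
    by (cases "b = simple_root s") (auto simp: srefl_simple_root_self pos_imp_root)
  assume "b \<in> roots"
  then consider "b \<in> pos_roots" | c where "b = vneg c" "c \<in> pos_roots"
    by (auto simp: roots_def)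
  then show ?thesis using pos by cases (simp_all add: srefl_vneg)
qed

lemma act_root: "b \<in> roots \<Longrightarrow> act w b \<in> roots"
  by (induction w) (simp_all add: srefl_root)

section \<open>Inversion sets of products\<close>

definition inversions :: "h4_gen list \<Rightarrow> hvec set" where
  "inversions w = {b \<in> pos_roots. act (rev w) b \<notin> pos_roots}"

lemma finite_inversions: "finite (inversions w)"
  by (simp add: inversions_def finite_pos_roots)

lemma inversions_Nil [simp]: "inversions [] = {}"
  by (simp add: inversions_def)

lemma act_pos_or: "b \<in> pos_roots \<Longrightarrow> act w b \<notin> pos_roots \<Longrightarrow> vneg (act w b) \<in> pos_roots"
  using neg_root_iff[OF act_root[OF pos_imp_root]] by blast

text \<open>A root on the left is inverted by \<open>u\<close>, or else the inverse of
  \<open>u\<close> keeps it positive and \<open>w\<close> inverts the result.\<close>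

lemma inversions_append_subset: "inversions (u @ w) \<subseteq> inversions u \<union> act u ` inversions w"
proof
  fix b assume b: "b \<in> inversions (u @ w)"
  then have *: "b \<in> pos_roots" "act (rev w) (act (rev u) b) \<notin> pos_roots"
    by (auto simp: inversions_def act_append)
  show "b \<in> inversions u \<union> act u ` inversions w"
  proof (cases "act (rev u) b \<in> pos_roots")
    case True
    then have "act (rev u) b \<in> inversions w" using * by (simp add: inversions_def)
    then have "act u (act (rev u) b) \<in> act u ` inversions w" by (rule imageI)
    then show ?thesis by simp
  qed (use * in \<open>simp add: inversions_def\<close>)
qed

lemma inversions_singleton: "inversions [s] = {simple_root s}"
proof -
  have "srefl s b \<in> pos_roots \<longleftrightarrow> b \<noteq> simple_root s" if "b \<in> pos_roots" for b
    using srefl_pos[OF that, of s] neg_root_iff[OF pos_imp_root[OF simple_root_pos[of s]]] simple_root_pos[of s]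
    by (cases "b = simple_root s") (auto simp: srefl_simple_root_self)
  then show ?thesis using simple_root_pos[of s] by (auto simp: inversions_def)
qed

text \<open>Under the hypothesis nothing cancels: \<open>inversions (u @ w)\<close> is the disjoint
  union of \<open>inversions u\<close> and the image of \<open>inversions w\<close> under
  \<open>act u\<close>.\<close>

lemma card_inversions_append_eq:
  assumes "inversions u \<subseteq> inversions (u @ w)"
  shows "card (inversions (u @ w)) = card (inversions u) + card (inversions w)"
proof -
  have "act u ` inversions w = inversions (u @ w) - inversions u"
  proof (intro equalityI subsetI)
    fix b assume "b \<in> act u ` inversions w"
    then obtain c where c: "b = act u c" "c \<in> pos_roots" "act (rev w) c \<notin> pos_roots"
      by (auto simp: inversions_def)
    \<comment> \<open>Otherwise \<open>vneg b\<close> is an inversion of \<open>u\<close>, hence of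
      \<open>u @ w\<close>, so the inverse of \<open>w\<close> keeps \<open>c\<close> positive,
      against its choice.\<close>
    have "b \<in> pos_roots"
    proof (rule ccontr)
      assume "b \<notin> pos_roots"
      then have "vneg b \<in> pos_roots" using c act_pos_or by simp
      moreover have "vneg c \<notin> pos_roots" using c(2) neg_root_iff pos_imp_root by blast
      ultimately have "vneg b \<in> inversions u" by (simp add: inversions_def c(1) act_vneg)
      with assms have "vneg b \<in> inversions (u @ w)" by blast
      then show False using c(2,3) act_pos_or[of c "rev w"] by (simp add: inversions_def c(1) act_vneg act_append)
    qed
    then show "b \<in> inversions (u @ w) - inversions u"
      using c by (simp add: inversions_def act_append)
  next
    fix b assume b: "b \<in> inversions (u @ w) - inversions u"
    then have "act (rev u) b \<in> inversions w" by (auto simp: inversions_def act_append)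
    then have "act u (act (rev u) b) \<in> act u ` inversions w" by (rule imageI)
    then show "b \<in> act u ` inversions w" by simp
  qed
  moreover have "inj (act u)" by (rule inj_on_inverseI[where g = "act (rev u)"]) simp
  then have "card (act u ` inversions w) = card (inversions w)"
    by (intro card_image) (rule inj_on_subset, auto)
  ultimately have "card (inversions w) = card (inversions (u @ w)) - card (inversions u)"
    using card_Diff_subset[OF finite_inversions assms] by simp
  then show ?thesis using card_mono[OF finite_inversions assms] by simp
qed

text \<open>Counting forces equality in the inclusion
  \<open>inversions_append_subset\<close>.\<close>

lemma inversions_subset_of_card:
  assumes "card (inversions u) + card (inversions w) \<le> card (inversions (u @ w))"
  shows "inversions u \<subseteq> inversions (u @ w)"
proof -
  have "card (inversions u \<union> act u ` inversions w) \<le> card (inversions u) + card (inversions w)"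
    using card_Un_le[of "inversions u" "act u ` inversions w"] card_image_le[OF finite_inversions, of "act u" w] by linarith
  then have "inversions (u @ w) = inversions u \<union> act u ` inversions w"
    using assms by (intro card_seteq inversions_append_subset) (simp_all add: finite_inversions)
  then show ?thesis by blast
qed

text \<open>Since the longest element acts as -1 on roots, the extra factor exchanges the inverted
  and the noninverted positive roots.\<close>

lemma inversions_w0: "inversions (u @ w0_word) = pos_roots - inversions u"
proof -
  have rev: "act (rev w0_word) b = vneg b" if "b \<in> roots" for b
  proof -
    have "act w0_word (vneg b) = b" using that by (auto simp: roots_def act_w0 act_vneg)
    then have "act (rev w0_word) (act w0_word (vneg b)) = act (rev w0_word) b" by simp
    then show ?thesis by simp
  qed
  show ?thesis
    using neg_root_iff act_root pos_imp_root by (auto simp: inversions_def act_append rev)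
qed

text \<open>Each letter adds at most one inversion, whether or not the word is reduced; this makes
  inversion sets computable from above.\<close>

lemma inversions_subset_inv_list: "inversions w \<subseteq> set (inv_list w)"
proof (induction w)
  case (Cons s w)
  then show ?case using inversions_append_subset[of "[s]" w] by (fastforce simp: inversions_singleton)
qed simp

section \<open>Length and the weak order\<close>

definition cls :: "h4_gen list \<Rightarrow> h4_gen letter list set" where
  "cls w = word_class (coxeter_relators h4_matrix) (map Gen w)"

definition len :: "h4_gen list \<Rightarrow> nat" where
  "len w = word_length W_H4 S_H4 (cls w)"

lemma cls_in_carrier: "cls w \<in> carrier W_H4"
  by (simp add: cls_def coxeter_group_def presented_group_carrier)

lemma cls_mult: "cls u \<otimes>\<^bsub>W_H4\<^esub> cls w = cls (u @ w)"
  by (simp add: cls_def coxeter_group_def)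

lemma cls_append_cong: "cls u = cls u' \<Longrightarrow> cls w = cls w' \<Longrightarrow> cls (u @ w) = cls (u' @ w')"
  by (simp flip: cls_mult)

lemma S_H4_eq: "S_H4 = range (\<lambda>i. cls [i])"
  by (simp add: coxeter_gens_def cls_def)

lemma gen_prod_cls: "gen_prod W_H4 (map (\<lambda>i. cls [i]) w) = cls w"
  using gen_prod_W_H4[of w] by (simp add: cls_def)

lemma list_S_H4: "set xs \<subseteq> S_H4 \<Longrightarrow> \<exists>w. xs = map (\<lambda>i. cls [i]) w"
  unfolding S_H4_eq by (simp add: ex_map_conv subset_iff image_iff)

lemma carrier_cls:
  assumes "g \<in> carrier W_H4"
  obtains w where "g = cls w"
  using W_H4_generated[OF assms] list_S_H4 gen_prod_cls by metis

lemma len_eq_Least: "len w = (LEAST n. \<exists>v. length v = n \<and> cls v = cls w)"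
proof -
  have "(\<exists>xs. set xs \<subseteq> S_H4 \<and> length xs = n \<and> gen_prod W_H4 xs = cls w) \<longleftrightarrow>
      (\<exists>v. length v = n \<and> cls v = cls w)" for n
  proof
    assume "\<exists>xs. set xs \<subseteq> S_H4 \<and> length xs = n \<and> gen_prod W_H4 xs = cls w"
    then show "\<exists>v. length v = n \<and> cls v = cls w"
      using list_S_H4 gen_prod_cls by (metis length_map)
  next
    assume "\<exists>v. length v = n \<and> cls v = cls w"
    then obtain v where "length v = n" "cls v = cls w" by blast
    then show "\<exists>xs. set xs \<subseteq> S_H4 \<and> length xs = n \<and> gen_prod W_H4 xs = cls w"
      by (intro exI[of _ "map (\<lambda>i. cls [i]) v"]) (auto simp: gen_prod_cls S_H4_eq)
  qed
  then show ?thesis by (simp add: len_def word_length_def)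
qed

lemma len_le: "cls v = cls w \<Longrightarrow> len w \<le> length v"
  unfolding len_eq_Least by (rule Least_le) blast

lemma len_cong: "cls v = cls w \<Longrightarrow> len v = len w"
  by (simp add: len_def)

lemma reduced_word:
  obtains v where "cls v = cls w" "length v = len w"
proof -
  have "\<exists>v. length v = len w \<and> cls v = cls w"
    unfolding len_eq_Least by (rule LeastI_ex) blast
  then show ?thesis using that by blast
qed

lemma len_append_le: "len (u @ w) \<le> len u + length w"
proof -
  obtain v where "cls v = cls u" "length v = len u" by (rule reduced_word)
  then show ?thesis using len_le[OF cls_append_cong[of v u w w]] by simp
qed

lemma cls_relator: "cls (concat (replicate (h4_matrix i j) [i, j])) = cls []"
proof -
  have "map Gen (concat (replicate n [i, j])) = concat (replicate n [Gen i, Gen j])" for n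
    by (induction n) simp_all
  then have "map Gen (concat (replicate (h4_matrix i j) [i, j])) \<in> coxeter_relators h4_matrix"
    unfolding coxeter_relators_def by auto
  then show ?thesis by (simp add: cls_def word_class_eq_iff pres_eq.relator)
qed

lemma cls_square: "cls (u @ [s, s] @ w) = cls (u @ w)"
proof -
  have "cls [s, s] = cls []" using cls_relator[of s s] by (simp add: h4_matrix_def)
  then have "cls (u @ [s, s] @ w) = cls (u @ [] @ w)" by (intro cls_append_cong HOL.refl)
  then show ?thesis by simp
qed

lemma cls_append_rev: "cls (w @ rev w) = cls []"
proof (induction w)
  case (Cons s w)
  have "cls ([s] @ (w @ rev w) @ [s]) = cls ([s] @ [] @ [s])"
    by (intro cls_append_cong HOL.refl Cons.IH)
  then show ?case using cls_square[of "[]" s "[]"] by simp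
qed simp

lemma cls_rev_of_append:
  assumes "cls (u @ w) = cls []"
  shows "cls u = cls (rev w)"
proof -
  have "cls (u @ (w @ rev w)) = cls (u @ [])"
    by (intro cls_append_cong HOL.refl cls_append_rev)
  moreover have "cls ((u @ w) @ rev w) = cls ([] @ rev w)"
    by (intro cls_append_cong HOL.refl assms)
  ultimately show ?thesis by simp
qed

section \<open>The action factors through the group\<close>

fun index :: "'i letter \<Rightarrow> 'i" where
  "index (Gen i) = i"
| "index (Inv i) = i"

lemma act_relator: "act (concat (replicate (h4_matrix i j) [i, j])) v = v"
  by (cases i; cases j; cases v) (simp_all add: h4_matrix_def doubleton_eq_iff eval_nat_numeral)

text \<open>All defining relations hold for the reflections; forgetting whether a letter is inverted
  is harmless because each of them is an involution.\<close>

lemma act_pres_eq: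
  assumes "pres_eq (coxeter_relators h4_matrix) u w"
  shows "act (map index u) v = act (map index w) v"
  using assms
proof (induction arbitrary: v)
  case (relator r)
  then obtain i j where "r = concat (replicate (h4_matrix i j) [Gen i, Gen j])"
    by (auto simp: coxeter_relators_def)
  moreover have "map index (concat (replicate n [Gen i, Gen j])) = concat (replicate n [i, j])" for n
    by (induction n) simp_all
  ultimately show ?case by (simp add: act_relator)
qed (simp_all add: act_append)

lemma act_cong: "cls u = cls w \<Longrightarrow> act u = act w"
  using act_pres_eq[of "map Gen u" "map Gen w"] by (auto simp: cls_def word_class_eq_iff comp_def)

text \<open>\<open>rev\<close> represents the inverse, which depends only on the group
  element.\<close>

lemma cls_rev_cong: "cls u = cls w \<Longrightarrow> cls (rev u) = cls (rev w)"
proof -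
  assume "cls u = cls w"
  then have "cls (rev u @ rev (rev w)) = cls (rev u @ u)"
    by (intro cls_append_cong) simp_all
  also have "\<dots> = cls []" using cls_append_rev[of "rev u"] by simp
  finally show ?thesis using cls_rev_of_append[of "rev u" w] by simp
qed

lemma inversions_cong: "cls u = cls w \<Longrightarrow> inversions u = inversions w"
  using act_cong[OF cls_rev_cong[of u w]] by (simp add: inversions_def)

section \<open>Dihedral subgroups and positivity\<close>

fun alt :: "nat \<Rightarrow> h4_gen \<Rightarrow> h4_gen \<Rightarrow> h4_gen list" where
  "alt 0 s t = []"
| "alt (Suc k) s t = alt k t s @ [t]"

text \<open>Appending the reverse of the right side to the left side gives the relator of
  \<open>s, t\<close> or of \<open>t, s\<close>, by the parity of
  \<open>h4_matrix s t\<close>.\<close>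

lemma braid: "cls (alt (h4_matrix s t) s t) = cls (alt (h4_matrix s t) t s)"
proof -
  have "cls (alt (h4_matrix s t) s t @ rev (alt (h4_matrix s t) t s)) = cls []"
    using cls_relator[of s t] cls_relator[of t s]
    by (cases s; cases t) (simp_all add: h4_matrix_def doubleton_eq_iff eval_nat_numeral)
  from cls_rev_of_append[OF this] show ?thesis by simp
qed

lemma length_alt [simp]: "length (alt k s t) = k"
  by (induction k s t rule: alt.induct) simp_all

lemma alt_add: "\<exists>u. alt (n + k) s t = u @ alt k s t"
  by (induction k s t rule: alt.induct) auto

lemma alternating_word:
  assumes "set y \<subseteq> {s, t}" "y \<noteq> [] \<Longrightarrow> last y = t" "\<And>u r v. y \<noteq> u @ [r, r] @ v"
  shows "y = alt (length y) s t"
  using assms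
proof (induction y arbitrary: s t rule: rev_induct)
  case (snoc r y)
  then have r: "r = t" by simp
  have "y = alt (length y) t s"
  proof (rule snoc.IH)
    show "set y \<subseteq> {t, s}" using snoc.prems(1) by auto
    show "last y = s" if "y \<noteq> []"
    proof (rule ccontr)
      assume "last y \<noteq> s"
      then have "last y = t" using snoc.prems(1) last_in_set[OF that] by auto
      then have "y @ [r] = butlast y @ [t, t] @ []" using that r append_butlast_last_id[OF that] by simp
      then show False using snoc.prems(3) by blast
    qed
    show "y \<noteq> u @ [q, q] @ v" for u q v
      using snoc.prems(3)[of u q "v @ [r]"] by auto
  qed
  then show ?case using r by simp
qed simp

text \<open>The rank two case of \<open>nonneg_act_simple_root\<close>: below the braid length, the
  root is a nonnegative combination of the two simple roots.\<close>

lemma dihedral_root_check: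
  "\<forall>s\<in>set gens. \<forall>t\<in>set gens. s \<noteq> t \<longrightarrow> list_all (\<lambda>k.
     (let b = act (alt k s t) (simple_root s) in
       nonneg b \<and> b = vadd (smul (coord s b) (simple_root s)) (smul (coord t b) (simple_root t))))
     [0..<h4_matrix s t]"
  by code_simp

lemma nonneg_coord: "nonneg b \<Longrightarrow> 0 \<le> fst (coord s b) \<and> 0 \<le> snd (coord s b)"
  by (cases s; cases b) simp_all

text \<open>\<open>act v\<close> is linear, so it carries the dihedral combination to one of two
  nonnegative vectors with nonnegative scalars.\<close>

lemma nonneg_act_alt:
  assumes "nonneg (act v (simple_root s))" "nonneg (act v (simple_root t))" "s \<noteq> t" "k < h4_matrix s t"
  shows "nonneg (act (v @ alt k s t) (simple_root s))"
proof -
  define b where "b = act (alt k s t) (simple_root s)"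
  have b: "nonneg b" "b = vadd (smul (coord s b) (simple_root s)) (smul (coord t b) (simple_root t))"
    using dihedral_root_check in_gens[of s] in_gens[of t] assms(3,4)
    by (auto simp: list_all_iff Let_def b_def)
  have "act v b = vadd (smul (coord s b) (act v (simple_root s))) (smul (coord t b) (act v (simple_root t)))"
    by (subst b(2)) (simp add: act_vadd act_smul)
  then have "nonneg (act v b)"
    using assms(1,2) b(1) by (simp add: nonneg_vadd nonneg_smul nonneg_coord)
  then show ?thesis by (simp add: act_append b_def)
qed

text \<open>The parabolic subgroup of \<open>s\<close> and a right descent \<open>t\<close> of \<open>w\<close> reduces the claim to a shorter
  coset representative \<open>v\<close> and a statement about a dihedral group.\<close>

lemma nonneg_act_simple_root:
  assumes "len w \<le> len (w @ [s])"
  shows "nonneg (act w (simple_root s))"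
  using assms
proof (induction "len w" arbitrary: w s rule: less_induct)
  case less
  obtain w' where w': "cls w' = cls w" "length w' = len w" by (rule reduced_word)
  show ?case
  proof (cases w' rule: rev_cases)
    case Nil
    then have "act w = act []" using act_cong[OF w'(1)] by simp
    then show ?thesis by (cases s) simp_all
  next
    case (snoc w'' t)
    \<comment> \<open>\<open>P\<close> collects the length-additive factorisations of
      \<open>w\<close> with right factor in the subgroup of \<open>s\<close> and \<open>t\<close>; a
      shortest left factor is the minimal coset representative.\<close>
    define P where "P = (\<lambda>(v, y). cls (v @ y) = cls w \<and> len w = len v + length y \<and> set y \<subseteq> {s, t})"
    have len_w'': "len w'' = length w''"
      using len_append_le[of w'' "[t]"] len_cong[OF w'(1)] w'(2) snoc len_le[of w'' w''] by simp
    then have P0: "P (w'', [t])" using w' snoc by (simp add: P_def)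
    define x where "x = arg_min (\<lambda>(v, y). len v) P"
    have "P x" and minx: "\<And>v y. P (v, y) \<Longrightarrow> len (fst x) \<le> len v"
      using arg_min_nat_lemma[of P "(w'', [t])" "\<lambda>(v, y). len v", OF P0] by (auto simp: x_def split_beta)
    then obtain v y where P: "P (v, y)" and min: "\<And>v' y'. P (v', y') \<Longrightarrow> len v \<le> len v'"
      by (cases x) auto
    have wvy: "cls (v @ y) = cls w" and len_w: "len w = len v + length y" and y: "set y \<subseteq> {s, t}"
      using P by (auto simp: P_def)
    \<comment> \<open>The factorisation \<open>(w'', [t])\<close> already has a left factor shorter
      than \<open>w\<close>, so the induction hypothesis will apply to \<open>v\<close>.\<close>
    have "len v < len w"
      using min[OF P0] len_w'' w'(2) snoc by simp
    \<comment> \<open>Otherwise \<open>(v @ [r], r # y)\<close> would be a factorisation with a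
      shorter left factor.\<close>
    have min_coset: "len v \<le> len (v @ [r])" if "r \<in> {s, t}" for r
    proof (rule ccontr)
      assume less: "\<not> len v \<le> len (v @ [r])"
      have "cls ((v @ [r]) @ r # y) = cls w"
        using cls_square[of v r y] wvy by simp
      moreover from this have "len w = len (v @ [r]) + length (r # y)"
        using len_append_le[of "v @ [r]" "r # y"] len_cong[of "(v @ [r]) @ r # y" w] less len_w by simp
      ultimately have "P (v @ [r], r # y)" using y that by (simp add: P_def)
      from min[OF this] less show False by simp
    qed
    have pos: "nonneg (act v (simple_root r))" if "r \<in> {s, t}" for r
      by (rule less.hyps[OF \<open>len v < len w\<close> min_coset[OF that]])
    have reduced: "length y \<le> length z" if "cls z = cls y" for z
    proof -
      have "cls (v @ z) = cls w" using that wvy cls_append_cong by metis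
      then show ?thesis using len_append_le[of v z] len_cong[of "v @ z" w] len_w by simp
    qed
    have no_descent: "length y \<le> length z" if "cls z = cls (y @ [s])" for z
    proof -
      have "cls (v @ z) = cls ((v @ y) @ [s])" using cls_append_cong[OF HOL.refl that, of v] by simp
      also have "\<dots> = cls (w @ [s])" by (rule cls_append_cong[OF wvy HOL.refl])
      finally show ?thesis using len_append_le[of v z] len_cong[of "v @ z" "w @ [s]"] len_w less.prems by simp
    qed
    \<comment> \<open>A reduced expression of \<open>y\<close> ending in \<open>s\<close> would make
      \<open>w @ [s]\<close> shorter than \<open>w\<close>.\<close>
    have not_s: False if "cls y = cls (z @ [s])" "Suc (length z) = length y" for z
    proof -
      have "cls (y @ [s]) = cls ((z @ [s]) @ [s])" by (rule cls_append_cong[OF that(1) HOL.refl])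
      also have "\<dots> = cls z" using cls_square[of z s "[]"] by simp
      finally show False using no_descent[of z] that(2) by simp
    qed
    have y_alt: "y = alt (length y) s t"
    proof (rule alternating_word[OF y])
      show "last y = t" if "y \<noteq> []"
      proof (rule ccontr)
        assume "last y \<noteq> t"
        then have "last y = s" using last_in_set[OF that] y by auto
        then have "y = butlast y @ [s]" using append_butlast_last_id[OF that] by simp
        then show False using not_s[of "butlast y"] that by simp
      qed
      show "y \<noteq> a @ [r, r] @ b" for a r b
        using reduced[of "a @ b"] cls_square[of a r b] by auto
    qed
    have "s \<noteq> t"
    proof
      assume "s = t"
      have "cls (w @ [s]) = cls ((w'' @ [t]) @ [s])" using w'(1) snoc cls_append_cong by metis
      also have "\<dots> = cls w''" using cls_square[of w'' s "[]"] \<open>s = t\<close> by simp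
      finally have "len (w @ [s]) = len w''" by (rule len_cong)
      then show False using less.prems len_w'' w'(2) snoc by simp
    qed
    \<comment> \<open>An alternating suffix of full braid length could be rewritten to end in
      \<open>s\<close>.\<close>
    have "length y < h4_matrix s t"
    proof (rule ccontr)
      let ?m = "h4_matrix s t"
      assume "\<not> length y < ?m"
      then obtain n where n: "length y = n + ?m" by (metis le_add_diff_inverse2 not_le)
      then obtain u where u: "y = u @ alt ?m s t" using alt_add[of n ?m s t] y_alt by metis
      obtain m' where m': "?m = Suc m'" by (cases ?m) (auto simp: h4_matrix_def split: if_splits)
      have "cls y = cls (u @ alt ?m t s)" unfolding u by (rule cls_append_cong[OF HOL.refl braid])
      also have "u @ alt ?m t s = (u @ alt m' s t) @ [s]" by (simp add: m')
      finally show False using not_s[of "u @ alt m' s t"] u m' by simp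
    qed
    then have "nonneg (act (v @ y) (simple_root s))"
      using nonneg_act_alt[of v s t "length y"] pos \<open>s \<noteq> t\<close> y_alt by simp
    then show ?thesis using act_cong[OF wvy] by simp
  qed
qed

text \<open>The last letter \<open>t\<close> of a reduced word \<open>u @ [t]\<close> adds exactly
  one inversion, since \<open>act u (simple_root t)\<close> is positive.\<close>

lemma len_eq_card_inversions: "len w = card (inversions w)"
proof (induction "len w" arbitrary: w rule: less_induct)
  case less
  obtain w' where w': "cls w' = cls w" "length w' = len w" by (rule reduced_word)
  show ?case
  proof (cases w' rule: rev_cases)
    case Nil
    then show ?thesis using w' inversions_cong[of w' w] by simp
  next
    case (snoc u t)
    have u: "len u = length u"
      using len_append_le[of u "[t]"] len_cong[OF w'(1)] w'(2) snoc len_le[of u u] by simp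
    then have "len u < len w" using w'(2) snoc by simp
    then have "nonneg (act u (simple_root t))"
      using len_cong[OF w'(1)] snoc by (intro nonneg_act_simple_root) simp
    then have pos: "act u (simple_root t) \<in> pos_roots"
      using pos_root_iff act_root pos_imp_root simple_root_pos by blast
    have "inversions u \<subseteq> inversions (u @ [t])"
    proof
      fix b assume b: "b \<in> inversions u"
      then have "b \<in> pos_roots" by (simp add: inversions_def)
      define c where "c = vneg (act (rev u) b)"
      have c: "c \<in> pos_roots" using b act_pos_or by (auto simp: c_def inversions_def)
      have "act u c = vneg b" by (simp add: c_def act_vneg)
      \<comment> \<open>\<open>act u\<close> makes \<open>c\<close> negative but keeps the simple
        root of \<open>t\<close> positive; hence the reflection in \<open>t\<close> leaves
        \<open>c\<close> positive.\<close>
      then have "c \<noteq> simple_root t"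
        using pos \<open>b \<in> pos_roots\<close> neg_root_iff pos_imp_root by metis
      then have "srefl t c \<in> pos_roots" using c by (simp add: srefl_pos)
      moreover have "act (rev (u @ [t])) b = vneg (srefl t c)" by (simp add: c_def srefl_vneg)
      ultimately show "b \<in> inversions (u @ [t])"
        using \<open>b \<in> pos_roots\<close> neg_root_iff pos_imp_root by (auto simp: inversions_def)
    qed
    from card_inversions_append_eq[OF this]
    have "card (inversions (u @ [t])) = Suc (card (inversions u))"
      by (simp add: inversions_singleton)
    then show ?thesis
      using less[OF \<open>len u < len w\<close>] u w'(2) snoc inversions_cong[OF w'(1)] by simp
  qed
qed

text \<open>Lengths add in \<open>v = u q\<close> exactly when inversion counts do, which the two
  counting lemmas tie to inclusion.\<close>

theorem right_weak_order_iff_inversions: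
  "(cls u, cls v) \<in> right_weak_order W_H4 S_H4 \<longleftrightarrow> inversions u \<subseteq> inversions v"
proof
  assume "(cls u, cls v) \<in> right_weak_order W_H4 S_H4"
  then obtain g where g: "g \<in> carrier W_H4" "cls v = cls u \<otimes>\<^bsub>W_H4\<^esub> g"
      "len v = len u + word_length W_H4 S_H4 g"
    by (auto simp: right_weak_order_def len_def)
  then obtain q where "g = cls q" by (auto elim: carrier_cls)
  with g have q: "cls v = cls (u @ q)" "len v = len u + len q"
    by (simp_all add: cls_mult len_def)
  then show "inversions u \<subseteq> inversions v"
    using inversions_subset_of_card[of u q] inversions_cong[OF q(1)] by (simp add: len_eq_card_inversions)
next
  assume sub: "inversions u \<subseteq> inversions v"
  define q where "q = rev u @ v"
  have "cls ((u @ rev u) @ v) = cls ([] @ v)" by (intro cls_append_cong cls_append_rev HOL.refl)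
  then have q: "cls (u @ q) = cls v" by (simp add: q_def)
  then have "len v = len u + len q"
    using card_inversions_append_eq[of u q] sub inversions_cong[OF q] by (simp add: len_eq_card_inversions)
  then have "word_length W_H4 S_H4 (cls v) = word_length W_H4 S_H4 (cls u) + word_length W_H4 S_H4 (cls q)"
    by (simp only: len_def)
  moreover have "cls v = cls u \<otimes>\<^bsub>W_H4\<^esub> cls q" by (simp only: q cls_mult)
  ultimately show "(cls u, cls v) \<in> right_weak_order W_H4 S_H4"
    unfolding right_weak_order_def using cls_in_carrier by blast
qed

section \<open>Conflicting critical pairs\<close>

lemma weak_order_w0_iff:
  "(cls a, cls (x @ w0_word)) \<in> right_weak_order W_H4 S_H4 \<longleftrightarrow> inversions a \<inter> inversions x = {}"
proof -
  have "inversions a \<subseteq> pos_roots" by (auto simp: inversions_def)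
  then show ?thesis unfolding right_weak_order_iff_inversions inversions_w0 by blast
qed

lemma separating_extension:
  assumes "realizer (carrier W_H4) (right_weak_order W_H4 S_H4) \<L>" "inversions a \<inter> inversions x \<noteq> {}"
  shows "\<exists>L\<in>\<L>. (cls (x @ w0_word), cls a) \<in> L \<and> (cls a, cls (x @ w0_word)) \<notin> L"
proof -
  obtain L where L: "L \<in> \<L>" "(cls a, cls (x @ w0_word)) \<notin> L"
    using assms weak_order_w0_iff[of a x] by (auto simp: realizer_def)
  then have "linear_order_on (carrier W_H4) L"
    using assms(1) by (simp add: realizer_def linear_extension_def)
  moreover from this have "refl_on (carrier W_H4) L" "total_on (carrier W_H4) L"
    by (auto simp: linear_order_on_def partial_order_on_def preorder_on_def)
  ultimately have "(cls (x @ w0_word), cls a) \<in> L"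
    using L(2) cls_in_carrier by (metis refl_onD total_on_def)
  with L show ?thesis by blast
qed

text \<open>Transitivity along \<open>a\<close>, \<open>y w0\<close>, \<open>b\<close>,
  \<open>x w0\<close>; no single extension can therefore separate both pairs.\<close>

lemma separating_extension_conflict:
  assumes "realizer (carrier W_H4) (right_weak_order W_H4 S_H4) \<L>" "L \<in> \<L>"
    and "inversions a \<inter> inversions y = {}" "inversions b \<inter> inversions x = {}"
    and "(cls (x @ w0_word), cls a) \<in> L" "(cls (y @ w0_word), cls b) \<in> L"
  shows "(cls a, cls (x @ w0_word)) \<in> L"
proof -
  have "(cls a, cls (y @ w0_word)) \<in> L" "(cls b, cls (x @ w0_word)) \<in> L"
    using assms(1-4) by (auto simp: realizer_def simp flip: weak_order_w0_iff)
  moreover have "trans L"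
    using assms(1,2)
    by (auto simp: realizer_def linear_extension_def linear_order_on_def partial_order_on_def preorder_on_def)
  ultimately show ?thesis using assms(6) by (meson transD)
qed

text \<open>The pair \<open>(a, x)\<close> encodes \<open>a \<nleq> x w\<^sub>0\<close>. The fifteen pairs were found by a computer search
  among the 2636 critical pairs of the weak order.\<close>

definition critical_words :: "(h4_gen list \<times> h4_gen list) list" where
  "critical_words =
     [([S1], [S1]),
      ([S2], [S2]),
      ([S3], [S3]),
      ([S4], [S4]),
      ([S3, S2], [S2, S3]),
      ([S1, S2, S1], [S2, S1, S2]),
      ([S1, S2, S3], [S3, S2, S1, S2, S1]),
      ([S1, S2, S3, S4], [S4, S3, S2, S1, S2, S1]),
      ([S4, S3, S2, S1, S2, S1, S3, S2, S1, S2, S3], [S1, S2, S1, S2, S3, S4]),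
      ([S2, S1, S2, S1, S3, S2, S1, S2, S4, S3, S2, S1, S2, S1, S3, S2, S1], [S4, S3, S2,
       S1, S2, S3]),
      ([S4, S3, S2, S1, S2, S1, S3, S2, S1, S4, S3, S2, S1, S2], [S3, S2, S1, S2, S1, S3,
       S2, S1, S4, S3, S2, S1, S2]),
      ([S4, S3, S2, S1, S2, S1, S3, S2, S1, S2, S4, S3, S2, S1, S2, S1], [S2, S1, S3, S2,
       S1, S2, S1, S3, S2, S1, S2, S4, S3, S2, S1, S2, S1, S3, S2, S1]),
      ([S4, S3, S2, S1, S2, S1, S3, S2, S1, S2, S3, S4, S3, S2, S1, S2, S1, S3, S2, S1, S2,
       S3, S4, S3, S2, S1, S2, S1, S3, S2, S1, S2, S4, S3, S2, S1, S2, S1], [S2, S1, S3, S2,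
       S1, S2, S3, S4]),
      ([S2, S1, S2, S1, S3, S2, S1, S2, S3, S4, S3, S2, S1, S2, S1, S3, S2, S1, S2, S3, S4,
       S3, S2, S1, S2, S1, S3, S2, S1, S2], [S3, S2, S1, S2, S4, S3, S2, S1, S2, S1, S3, S2,
       S1, S4, S3, S2, S1, S2]),
      ([S3, S4, S3, S2, S1, S2, S1, S3, S2, S1, S2, S3, S4, S3, S2, S1, S2, S1, S3, S2, S1,
       S2, S3, S4, S3, S2, S1, S2, S1, S3, S2, S1, S2, S3], [S1, S2, S1, S2, S3, S2, S1, S2,
       S1, S3, S2, S1, S4, S3, S2, S1, S2, S3])]"

definition conflict_edges :: "(nat \<times> nat) list" where
  "conflict_edges =
     [(0, 1), (0, 2), (1, 2), (0, 3), (1, 3), (2, 3), (0, 4), (3, 4), (2, 5), (3, 5), (4,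
      5), (1, 6), (3, 6), (5, 6), (1, 7), (2, 7), (5, 7), (1, 8), (4, 8), (0, 9), (6, 9),
      (7, 9), (0, 10), (1, 10), (8, 10), (0, 11), (5, 11), (8, 11), (10, 11), (0, 12), (2,
      12), (5, 12), (0, 13), (6, 13), (7, 13), (9, 13), (1, 14), (4, 14), (8, 14), (12, 14)]"

text \<open>A certificate that the two inversion sets of a pair meet: the last letters of
  \<open>a\<close> and \<open>x\<close> contribute the same positive root.\<close>

lemma critical_words_check:
  "length critical_words = 15 \<and>
   list_all (\<lambda>(a, x). a \<noteq> [] \<and> x \<noteq> [] \<and> nonneg (act (butlast a) (simple_root (last a))) \<and>
     act (butlast x) (simple_root (last x)) = act (butlast a) (simple_root (last a))) critical_words"
  by code_simp

text \<open>The inversion lists are an argument so that they are computed only once.\<close>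

definition edge_disjoint :: "('a list \<times> 'a list) list \<Rightarrow> nat \<times> nat \<Rightarrow> bool" where
  "edge_disjoint ps = (\<lambda>(i, j).
     list_all (\<lambda>b. b \<notin> set (snd (ps ! j))) (fst (ps ! i)) \<and>
     list_all (\<lambda>b. b \<notin> set (snd (ps ! i))) (fst (ps ! j)))"

lemma conflict_edges_check:
  "list_all (\<lambda>(i, j). i < 15 \<and> j < 15) conflict_edges \<and>
   list_all (edge_disjoint (map (map_prod inv_list inv_list) critical_words)) conflict_edges"
  by code_simp

lemma conflict_edges_disjoint:
  assumes "(i, j) \<in> set conflict_edges"
  shows "i < 15" "j < 15"
    and "inversions (fst (critical_words ! i)) \<inter> inversions (snd (critical_words ! j)) = {}"
    and "inversions (fst (critical_words ! j)) \<inter> inversions (snd (critical_words ! i)) = {}"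
proof -
  show ij: "i < 15" "j < 15"
    using assms conflict_edges_check by (auto simp: list_all_iff)
  have "edge_disjoint (map (map_prod inv_list inv_list) critical_words) (i, j)"
    using assms conflict_edges_check by (auto simp: list_all_iff)
  then have "set (inv_list (fst (critical_words ! i))) \<inter> set (inv_list (snd (critical_words ! j))) = {}"
    "set (inv_list (fst (critical_words ! j))) \<inter> set (inv_list (snd (critical_words ! i))) = {}"
    using ij critical_words_check by (auto simp: edge_disjoint_def list_all_iff)
  then show "inversions (fst (critical_words ! i)) \<inter> inversions (snd (critical_words ! j)) = {}"
    "inversions (fst (critical_words ! j)) \<inter> inversions (snd (critical_words ! i)) = {}"
    using inversions_subset_inv_list by blast+
qed

text \<open>Undoing all letters but the last returns this root to the last simple root, which the
  last reflection negates.\<close>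

lemma last_root_inversion:
  assumes "w \<noteq> []" "nonneg (act (butlast w) (simple_root (last w)))"
  shows "act (butlast w) (simple_root (last w)) \<in> inversions w"
proof -
  define u s where "u = butlast w" and "s = last w"
  have w: "w = u @ [s]" using assms(1) by (simp add: u_def s_def)
  have "act u (simple_root s) \<in> pos_roots"
    using assms(2) pos_root_iff act_root pos_imp_root simple_root_pos u_def s_def by blast
  moreover have "vneg (simple_root s) \<notin> pos_roots"
    using neg_root_iff simple_root_pos pos_imp_root by blast
  ultimately have "act u (simple_root s) \<in> inversions w"
    by (simp add: inversions_def w srefl_simple_root_self)
  then show ?thesis by (simp add: u_def s_def)
qed

lemma critical_words_meet:
  assumes "i < 15"
  shows "inversions (fst (critical_words ! i)) \<inter> inversions (snd (critical_words ! i)) \<noteq> {}"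
proof -
  obtain a x where ax: "critical_words ! i = (a, x)" by (cases "critical_words ! i")
  then have "(a, x) \<in> set critical_words"
    using assms critical_words_check nth_mem[of i critical_words] by simp
  then have check: "a \<noteq> []" "x \<noteq> []" "nonneg (act (butlast a) (simple_root (last a)))"
      "act (butlast x) (simple_root (last x)) = act (butlast a) (simple_root (last a))"
    using critical_words_check by (auto simp: list_all_iff)
  from check have "act (butlast a) (simple_root (last a)) \<in> inversions a \<inter> inversions x"
    using last_root_inversion[of a] last_root_inversion[of x] by simp
  then show ?thesis using ax by auto
qed

text \<open>The vertices 0 to 3 are a clique. If vertex 5 had the colour of 0, the colours of 6, 7 and 9
  would be forced and none would remain for 13; so it has the colour of 1, which forces those of
  4, 12, 14, 8 and 10 in turn and leaves none for 11.\<close>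

lemma conflict_graph_not_4_colourable:
  fixes f :: "nat \<Rightarrow> 'a"
  assumes "finite C" "card C \<le> 4" and f: "\<And>i. i < 15 \<Longrightarrow> f i \<in> C"
    and "\<forall>(i, j)\<in>set conflict_edges. f i \<noteq> f j"
  shows False
proof -
  note neq = assms(4)[unfolded conflict_edges_def, simplified]
  have "card {f 0, f 1, f 2, f 3} = 4" using neq by auto
  moreover have "{f 0, f 1, f 2, f 3} \<subseteq> C" using f by auto
  ultimately have "C = {f 0, f 1, f 2, f 3}"
    using card_seteq[OF assms(1)] assms(2) by metis
  then have col: "f i = f 0 \<or> f i = f 1 \<or> f i = f 2 \<or> f i = f 3" if "i < 15" for i
    using f[OF that] by auto
  have "f 5 \<noteq> f 0"
  proof
    assume "f 5 = f 0"
    then have "f 6 = f 2" "f 7 = f 3" using col[of 6] col[of 7] neq by auto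
    then have "f 9 = f 1" using col[of 9] neq by auto
    then show False using \<open>f 6 = f 2\<close> \<open>f 7 = f 3\<close> col[of 13] neq by auto
  qed
  then have "f 5 = f 1" using col[of 5] neq by auto
  then have "f 4 = f 2" "f 12 = f 3" using col[of 4] col[of 12] neq by auto
  then have "f 14 = f 0" using col[of 14] neq by auto
  then have "f 8 = f 3" using \<open>f 4 = f 2\<close> col[of 8] neq by auto
  then have "f 10 = f 2" using col[of 10] neq by auto
  then show False using \<open>f 5 = f 1\<close> \<open>f 8 = f 3\<close> col[of 11] neq by auto
qed

section \<open>The lower bound for realizers\<close>

text \<open>Choosing a separating extension for each pair colours the conflict graph with members of
  the realizer.\<close>

lemma card_realizer_ge_5:
  assumes "finite \<L>" and real: "realizer (carrier W_H4) (right_weak_order W_H4 S_H4) \<L>"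
  shows "5 \<le> card \<L>"
proof (rule ccontr)
  assume card: "\<not> 5 \<le> card \<L>"
  define a x where "a i = fst (critical_words ! i)" and "x i = snd (critical_words ! i)" for i
  have "\<forall>i\<in>{..<15}. \<exists>L. L \<in> \<L> \<and> (cls (x i @ w0_word), cls (a i)) \<in> L \<and> (cls (a i), cls (x i @ w0_word)) \<notin> L"
    using separating_extension[OF real critical_words_meet] by (auto simp: a_def x_def)
  then obtain f where f: "\<And>i. i < 15 \<Longrightarrow> f i \<in> \<L> \<and> (cls (x i @ w0_word), cls (a i)) \<in> f i \<and>
      (cls (a i), cls (x i @ w0_word)) \<notin> f i"
    by (metis bchoice lessThan_iff)
  \<comment> \<open>A common extension would contain the very relation that \<open>f i\<close> was
    chosen to omit.\<close>
  have "f i \<noteq> f j" if "(i, j) \<in> set conflict_edges" for i j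
    using conflict_edges_disjoint[OF that] f[of i] f[of j]
      separating_extension_conflict[OF real, of "f i" "a i" "x j" "a j" "x i"]
    by (auto simp: a_def x_def)
  then show False
    using conflict_graph_not_4_colourable[of \<L> f] assms(1) card f by auto
qed

theorem theorem2p1:
  shows "order_dim (carrier W_H4) (right_weak_order W_H4 S_H4) \<ge> 5"
  unfolding order_dim_def
proof (rule INF_greatest)
  fix \<L> assume "\<L> \<in> {\<L>. finite \<L> \<and> realizer (carrier W_H4) (right_weak_order W_H4 S_H4) \<L>}"
  then show "5 \<le> enat (card \<L>)" using card_realizer_ge_5[of \<L>] by (simp add: numeral_eq_enat)
qed

end
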